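(* Let $k\in\{0,\ldots,n\}$ and let $\hat f=\sum_{S\subseteq N}a(S)\,\min_S\in V_n$. Write $A_k(\hat f)=\sum_{S\subseteq N,\ |S|\leqslant k}a_k(S)\,\min_S$. Then, for every $S\subseteq N$ with $s\leqslant k$, $$ a_k(S)=a(S)+(-1)^{k+s}\sum_{T\supseteq S,\ t>k}\frac{\binom{k+s+1}{k+1}\binom{t-s-1}{k-s}}{\binom{k+t+1}{k+1}}\,a(T), $$ where the sum is over subsets $T$ of $N$.
   Context: Let $n\geqslant 1$ and $N=\{1,\ldots,n\}$. Cardinalities of subsets $S,T$ are denoted by $s=|S|$, $t=|T|$. For $S\subseteq N$, the function $\min_S:[0,1]^n\to\mathbb{R}$ is $\min_S(\mathbf{x}):=\min_{i\in S}x_i$, with $\min_{\varnothing}\equiv 1$. For $k\in\{0,\ldots,n\}$, $V_k$ is the set of min-polynomials of degree at most $k$, i.e., functions $\sum_{S\subseteq N,\ |S|\leqslant k}a_k(S)\min_S$ with real coefficients $a_k(S)$. $V_k$ is a linear subspace of the space of continuous functions on $[0,1]^n$ and the functions $\min_S$ with $|S|\leqslant k$ form a basis of it, so coefficients are uniquely determined. ($V_n$ is the set of all Lov\'asz extensions of pseudo-Boolean functions $\{0,1\}^n\to\mathbb{R}$.) $V_n$ carries the inner product $\langle f_1,f_2\rangle:=\int_{[0,1]^n}f_1(\mathbf{x})f_2(\mathbf{x})\,d\mathbf{x}$, and $A_k:V_n\to V_k$ denotes the orthogonal projector from $V_n$ onto $V_k$; $A_k(\hat f)$ is the best $k$th approximation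 of $\hat f$, i.e., the unique minimizer of $\int_{[0,1]^n}[\hat f(\mathbf{x})-\hat g(\mathbf{x})]^2\,d\mathbf{x}$ over $\hat g\in V_k$. *)

theory Defs
  imports "HOL-Analysis.Analysis"
begin

(* The index set N = {1,...,n} is represented by UNIV :: 'n set for a finite type 'n,
   so that n = CARD('n) >= 1. Real functions on [0,1]^n are represented by extensional
   functions on unit_cube: two of them are equal iff they agree on the cube. *)

definition unit_cube :: "(real ^ 'n) set" where
  "unit_cube = {x. \<forall>i. x $ i \<in> {0..1}}"

definition min_on :: "'n::finite set \<Rightarrow> real ^ 'n \<Rightarrow> real" where
  "min_on S x = (if S = {} then 1 else Min ((\<lambda>i. x $ i) ` S))"

(* Only the values of a on sets of cardinality at most k matter. *)
definition min_poly :: "nat \<Rightarrow> ('n::finite set \<Rightarrow> real) \<Rightarrow> real ^ 'n \<Rightarrow> real" where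
  "min_poly k a = (\<lambda>x\<in>unit_cube. \<Sum>S | card S \<le> k. a S * min_on S x)"

definition min_polys :: "nat \<Rightarrow> (real ^ 'n::finite \<Rightarrow> real) set" where
  "min_polys k = range (min_poly k)"

definition cube_inner :: "(real ^ 'n::finite \<Rightarrow> real) \<Rightarrow> (real ^ 'n \<Rightarrow> real) \<Rightarrow> real" where
  "cube_inner f g = (LINT x:unit_cube|lborel. f x * g x)"

(* Orthogonal projection onto min_polys k with respect to cube_inner; meant for f in min_polys CARD('n). *)
definition min_proj :: "nat \<Rightarrow> (real ^ 'n::finite \<Rightarrow> real) \<Rightarrow> real ^ 'n \<Rightarrow> real" where
  "min_proj k f = (THE g. g \<in> min_polys k \<and> (\<forall>h\<in>min_polys k. cube_inner (\<lambda>x. f x - g x) h = 0))"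

end

theory Submission
  imports Defs "HOL-Computational_Algebra.Polynomial"
begin

text \<open>
  Let \<open>t > k\<close>. By linearity the claim is that the best \<open>k\<close>-th approximation of
  \<open>min_on T\<close>, \<open>t = card T\<close>, is \<open>\<Sum>S\<subseteq>T. c S * min_on S\<close>, the sum running over sets of size at
  most \<open>k\<close> and \<open>c S\<close> being the coefficients of the theorem. A projection is characterised by
  orthogonality, so only the Gram matrix of the functions \<open>min_on S\<close> is needed. Writing
  each minimum as the measure of its superlevels and exchanging integrals, the inner product of
  \<open>min_on S\<close> and \<open>min_on R\<close> becomes a double integral of volumes of boxes
  (\<open>emeasure_corner_box\<close>), and its value is
  \<open>(s + r + 2) / ((s + 1) (r + 1) (card (S \<union> R) + 2))\<close> (\<open>cube_inner_min_on\<close>).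

  Orthogonality rests on one observation about the coefficients. As a function of \<open>s\<close>, the
  number \<open>binomial (k + s + 1) (k + 1) * binomial (t - s - 1) (k - s)\<close> is, for \<open>s \<le> k\<close>, a constant
  multiple of \<open>(s + 1) \<cdots> (s + k + 1) * (s - k - 1) \<cdots> (s - t + 1)\<close>. This polynomial vanishes
  for \<open>k < s < t\<close>, and at \<open>s = t\<close>, with the sign \<open>(-1)^s\<close> and the same normalisation as for
  \<open>s \<le> k\<close>, it gives the coefficient 1 of \<open>min_on T\<close> in the difference of \<open>min_on T\<close> and its
  approximation. So the coefficients of the whole difference
  \<open>min_on T - (\<Sum>S. c S * min_on S)\<close> are \<open>(-1)^s\<close> times a single polynomial. Its inner product
  with \<open>min_on R\<close>, where \<open>r \<le> k\<close>, is up to a constant factor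
  \<open>\<Sum>S\<subseteq>T. (-1)^s * G s / (r + 2 + card (S - R))\<close> with
  \<open>G s = (s + r + 2) * (s + 2) \<cdots> (s + k + 1) * (s - k - 1) \<cdots> (s - t + 1)\<close>, of degree \<open>t\<close>.

  This sum is zero. Split \<open>S\<close> into \<open>X = S \<inter> R\<close> and \<open>Y = S - R\<close>. The sum over \<open>X \<subseteq> T \<inter> R\<close> is an
  iterated finite difference, which leaves a polynomial \<open>L\<close> in \<open>q = card Y\<close> of degree at most
  \<open>card (T - R)\<close>. The numbers \<open>p - (r + 2)\<close> for \<open>0 \<le> p \<le> r\<close> are roots of \<open>G\<close>, hence
  \<open>L (- (r + 2)) = 0\<close> and the denominator \<open>q + r + 2\<close> divides \<open>L\<close>. The quotient has degree less
  than \<open>card (T - R)\<close> and is therefore annihilated by the alternating sum over \<open>Y \<subseteq> T - R\<close>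
  (\<open>alternating_sum_div_eq_0\<close>, applied in \<open>gram_proj_coeff\<close>).

  That the projection and its coefficients are well defined follows from the definiteness of the
  inner product on continuous functions (\<open>cube_inner_self_eq_0D\<close>) and from the linear
  independence of the functions \<open>min_on S\<close>, which is visible on the vertices of the cube
  (\<open>min_comb_eq_0D\<close>).
\<close>

section \<open>Alternating sums of polynomials over subsets\<close>

text \<open>
  The iterated difference operator \<open>P(x) \<mapsto> P(x) - P(x + 1)\<close>, applied once for each element of
  \<open>A\<close>. It is written as a sum over subsets, and not with binomial coefficients, because the sums
  to which it is applied run over sets of indices.
\<close>
definition alt_shift_sum :: "'a set \<Rightarrow> real poly \<Rightarrow> real poly" where
  "alt_shift_sum A P = (\<Sum>X\<in>Pow A. smult ((-1) ^ card X) (pcompose P [:real (card X), 1:]))"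

lemma coeff_pcompose_shift_diff:
  fixes P :: "real poly"
  assumes "\<forall>j\<ge>Suc m. coeff P j = 0"
  shows "\<forall>j\<ge>m. coeff (P - pcompose P [:1, 1:]) j = 0"
proof (intro allI impI)
  fix j assume "m \<le> j"
  have deg: "degree (pcompose P [:1, 1:]) = degree P"
    by (simp add: degree_pcompose)
  have lead: "lead_coeff (pcompose P [:1, 1:]) = lead_coeff P"
    by (subst lead_coeff_comp) auto
  have "degree P \<le> m" using assms by (intro degree_le) auto
  show "coeff (P - pcompose P [:1, 1:]) j = 0"
  proof (cases "j = degree P")
    case True
    then show ?thesis using lead deg by simp
  next
    case False
    with \<open>degree P \<le> m\<close> \<open>m \<le> j\<close> have "degree P < j" by simp
    then show ?thesis using deg by (simp add: coeff_eq_0)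
  qed
qed

lemma alt_shift_sum_insert:
  assumes "finite A" "a \<notin> A"
  shows "alt_shift_sum (insert a A) P = alt_shift_sum A (P - pcompose P [:1, 1:])"
proof -
  have inj: "inj_on (insert a) (Pow A)" using assms by (auto simp: inj_on_def)
  have disj: "Pow A \<inter> insert a ` Pow A = {}" using assms by auto
  have shift: "pcompose P [:real (card (insert a X)), 1:]
      = pcompose (pcompose P [:1, 1:]) [:real (card X), 1:]" if "X \<in> Pow A" for X
  proof -
    have "card (insert a X) = Suc (card X)"
      using that assms by (subst card_insert_disjoint) (auto intro: finite_subset)
    then show ?thesis
      by (simp flip: pcompose_assoc add: pcompose_pCons)
  qed
  have "alt_shift_sum (insert a A) P = alt_shift_sum A P
      + (\<Sum>X\<in>Pow A. smult ((-1) ^ card (insert a X)) (pcompose P [:real (card (insert a X)), 1:]))"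
    unfolding alt_shift_sum_def Pow_insert
    using assms inj disj by (subst sum.union_disjoint) (auto simp: sum.reindex)
  also have "(\<Sum>X\<in>Pow A. smult ((-1) ^ card (insert a X)) (pcompose P [:real (card (insert a X)), 1:]))
      = - alt_shift_sum A (pcompose P [:1, 1:])"
    unfolding alt_shift_sum_def sum_negf[symmetric]
  proof (rule sum.cong[OF refl], subst shift)
    fix X assume "X \<in> Pow A"
    then have "card (insert a X) = Suc (card X)"
      using assms by (subst card_insert_disjoint) (auto intro: finite_subset)
    then show "smult ((-1) ^ card (insert a X)) (pcompose (pcompose P [:1, 1:]) [:real (card X), 1:])
      = - smult ((-1) ^ card X) (pcompose (pcompose P [:1, 1:]) [:real (card X), 1:])" by simp
  qed auto
  finally show ?thesis
    by (simp add: alt_shift_sum_def pcompose_diff smult_diff_right sum_subtractf)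
qed

text \<open>
  Each difference lowers the degree by one. The bound is stated through vanishing coefficients so
  that \<open>m = 0\<close> says that the result is the zero polynomial.
\<close>
lemma coeff_alt_shift_sum_eq_0:
  assumes "finite A" "\<forall>j\<ge>card A + m. coeff P j = 0"
  shows "\<forall>j\<ge>m. coeff (alt_shift_sum A P) j = 0"
  using assms
proof (induction A arbitrary: P rule: finite_induct)
  case empty
  then show ?case by (simp add: alt_shift_sum_def)
next
  case (insert a A)
  then have "\<forall>j\<ge>card A + m. coeff (P - pcompose P [:1, 1:]) j = 0"
    by (intro coeff_pcompose_shift_diff) auto
  then show ?case
    unfolding alt_shift_sum_insert[OF insert.hyps] by (rule insert.IH)
qed

lemma poly_alt_shift_sum:
  "poly (alt_shift_sum A P) x = (\<Sum>X\<in>Pow A. (-1) ^ card X * poly P (real (card X) + x))"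
  by (simp add: alt_shift_sum_def poly_sum poly_pcompose add.commute)

text \<open>
  The assumption on the roots makes the inner sum, as a polynomial in \<open>card Y\<close>, divisible by the
  denominator. Both together have used up \<open>card A + 1\<close> degrees, so the sum over the
  subsets of \<open>B\<close> is a difference of higher order than the degree of the quotient.
\<close>
lemma alternating_sum_div_eq_0:
  fixes G :: "real poly" and c :: real
  assumes fin: "finite A" "finite B" and deg: "degree G \<le> card A + card B"
    and c: "c > 0" and roots: "\<And>p. p \<le> card A \<Longrightarrow> poly G (real p - c) = 0"
  shows "(\<Sum>Y\<in>Pow B. \<Sum>X\<in>Pow A. (-1) ^ (card X + card Y) * poly G (real (card X + card Y)) / (c + card Y)) = 0"
proof -
  define L where "L = alt_shift_sum A G"
  have "\<forall>j\<ge>card A + Suc (card B). coeff G j = 0"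
    using deg by (auto intro!: coeff_eq_0)
  then have L0: "\<forall>j\<ge>Suc (card B). coeff L j = 0"
    unfolding L_def using fin by (intro coeff_alt_shift_sum_eq_0)
  have "poly L (- c) = 0"
    unfolding L_def poly_alt_shift_sum
    using roots fin by (intro sum.neutral) (auto simp: card_mono)
  then obtain M where M: "L = [:c, 1:] * M"
    by (metis poly_eq_0_iff_dvd dvdE minus_minus)
  have "\<forall>j\<ge>card B + 0. coeff M j = 0"
  proof (cases "M = 0")
    case False
    then have "degree L = Suc (degree M)" unfolding M by (subst degree_mult_eq) auto
    moreover have "degree L \<le> card B" using L0 by (intro degree_le) auto
    ultimately show ?thesis by (auto intro!: coeff_eq_0)
  qed auto
  then have "\<forall>j\<ge>0. coeff (alt_shift_sum B M) j = 0"
    using fin by (intro coeff_alt_shift_sum_eq_0)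
  then have M0: "alt_shift_sum B M = 0" by (simp add: poly_eq_iff)
  have "(\<Sum>Y\<in>Pow B. \<Sum>X\<in>Pow A. (-1) ^ (card X + card Y) * poly G (real (card X + card Y)) / (c + card Y))
      = (\<Sum>Y\<in>Pow B. (-1) ^ card Y * (poly L (real (card Y)) / (c + card Y)))"
    unfolding L_def poly_alt_shift_sum
    by (simp add: sum_distrib_left sum_divide_distrib power_add mult_ac)
  also have "\<dots> = (\<Sum>Y\<in>Pow B. (-1) ^ card Y * poly M (real (card Y)))"
  proof (rule sum.cong[OF refl])
    fix Y
    have "c + real (card Y) \<noteq> 0" using c by (simp add: add_pos_nonneg less_imp_neq[THEN not_sym])
    moreover have "poly L (real (card Y)) = (c + real (card Y)) * poly M (real (card Y))"
      by (simp add: M algebra_simps)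
    ultimately show "(-1) ^ card Y * (poly L (real (card Y)) / (c + card Y))
      = (-1) ^ card Y * poly M (real (card Y))" by simp
  qed
  also have "\<dots> = poly (alt_shift_sum B M) 0" by (simp add: poly_alt_shift_sum)
  finally show ?thesis using M0 by simp
qed

lemma sum_Pow_split:
  fixes g :: "nat \<Rightarrow> nat \<Rightarrow> real"
  assumes "finite T"
  shows "(\<Sum>S\<in>Pow T. g (card S) (card (S - R)))
    = (\<Sum>Y\<in>Pow (T - R). \<Sum>X\<in>Pow (T \<inter> R). g (card X + card Y) (card Y))"
proof -
  have "(\<Sum>Y\<in>Pow (T - R). \<Sum>X\<in>Pow (T \<inter> R). g (card X + card Y) (card Y))
    = (\<Sum>(Y, X)\<in>Pow (T - R) \<times> Pow (T \<inter> R). g (card X + card Y) (card Y))"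
    by (rule sum.cartesian_product)
  also have "\<dots> = (\<Sum>S\<in>Pow T. g (card S) (card (S - R)))"
  proof (rule sum.reindex_bij_witness[where i = "\<lambda>S. (S - R, S \<inter> R)" and j = "\<lambda>(Y, X). X \<union> Y"], goal_cases)
    case (5 a)
    obtain Y X where a: "a = (Y, X)" by force
    have "card (X \<union> Y) = card X + card Y"
      using 5 assms a by (intro card_Un_disjoint) (auto intro: finite_subset[of _ T])
    moreover have "X \<union> Y - R = Y" using 5 a by auto
    ultimately show ?case by (simp add: a)
  qed auto
  finally show ?thesis ..
qed

section \<open>The coefficients of the projection and the Gram matrix\<close>

text \<open>
  The products of \<open>prod_shift_up\<close> and \<open>prod_shift_down\<close> are the factors of the polynomial behind the
  coefficients. The factor
  \<open>s + 1\<close> stands apart because it cancels against the same factor in the denominator of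
  the Gram matrix.
\<close>
lemma prod_shift_up:
  "real (k + s + 1 choose (k + 1)) * fact (k + 1) = (\<Prod>m\<in>{2..k + 1}. real s + real m) * (real s + 1)"
proof -
  have "real (k + s + 1 choose (k + 1)) * fact (k + 1) = (\<Prod>m\<in>{1..k + 1}. real s + real m)"
  proof (induction k)
    case (Suc k)
    have "real (Suc k + s + 1 choose (Suc k + 1)) * real (k + 2)
        = real (k + s + 1 choose (k + 1)) * real (k + s + 2)"
      using Suc_times_binomial_eq[of "k + s + 1" "k + 1"]
      by (metis (no_types, lifting) Suc_eq_plus1 add_Suc add_Suc_right add_2_eq_Suc' of_nat_mult mult.commute)
    moreover have fact: "fact (Suc k + 1) = real (k + 2) * fact (k + 1)" by simp
    ultimately have "real (Suc k + s + 1 choose (Suc k + 1)) * fact (Suc k + 1)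
        = (real (k + s + 1 choose (k + 1)) * fact (k + 1)) * real (k + s + 2)"
      by (simp only: fact) (metis mult.assoc mult.commute)
    also have "\<dots> = (\<Prod>m\<in>{1..k + 1}. real s + real m) * real (k + s + 2)" by (simp only: Suc)
    finally show ?case by (simp add: add_ac)
  qed simp
  also have "{1..k + 1} = insert 1 {2..k + 1}" by auto
  finally show ?thesis by (simp add: mult.commute)
qed

lemma prod_shift_down:
  assumes "s \<le> k" "k < t"
  shows "(\<Prod>m\<in>{k + 1..<t}. real m - real s) = real (t - s - 1 choose (k - s)) * fact (t - k - 1)"
proof -
  have "(\<Prod>m\<in>{k + 1..<k + 1 + d}. real m - real s) = real (d + (k - s) choose d) * fact d" for d
  proof (induction d)
    case (Suc d)
    have "real (Suc d + (k - s) choose Suc d) * real (Suc d)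
        = real (d + (k - s) choose d) * real (d + (k - s) + 1)"
      using Suc_times_binomial_eq[of "d + (k - s)" d]
      by (metis Suc_eq_plus1 add_Suc of_nat_mult mult.commute)
    then have "real (Suc d + (k - s) choose Suc d) * fact (Suc d)
        = (real (d + (k - s) choose d) * fact d) * real (d + (k - s) + 1)"
      by (simp only: fact_Suc) (metis mult.assoc mult.commute)
    also have "\<dots> = (\<Prod>m\<in>{k + 1..<k + 1 + d}. real m - real s) * (real (k + 1 + d) - real s)"
      using assms Suc by (simp add: of_nat_diff algebra_simps)
    finally show ?case by simp
  qed simp
  from this[of "t - k - 1"] show ?thesis using assms
    by (simp add: binomial_symmetric[of "k - s" "t - Suc s"])
qed

text \<open>
  The inner product of \<open>min_on S\<close> and \<open>min_on R\<close>, as is shown in \<open>cube_inner_min_on\<close>.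
\<close>
definition min_gram :: "'a set \<Rightarrow> 'a set \<Rightarrow> real" where
  "min_gram S R = real (card S + card R + 2)
     / (real (card S + 1) * real (card R + 1) * real (card (S \<union> R) + 2))"

text \<open>
  The coefficient of \<open>min_on S\<close> in the best \<open>k\<close>-th approximation of \<open>min_on T\<close>, for
  \<open>S \<subseteq> T\<close>, \<open>s = card S \<le> k\<close> and \<open>t = card T > k\<close>.
\<close>
definition proj_coeff :: "nat \<Rightarrow> nat \<Rightarrow> nat \<Rightarrow> real" where
  "proj_coeff k s t = (-1) ^ (k + s) *
     (real ((k + s + 1) choose (k + 1)) * real ((t - s - 1) choose (k - s))
              / real ((k + t + 1) choose (k + 1)))"

text \<open>
  These are the normal equations for the approximation of \<open>min_on T\<close>. After multiplication by the
  constant \<open>K\<close>, the difference of the two sides is the sum of \<open>(-1)^s * G s / (r + 2 + card (S - R))\<close>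
  over all subsets \<open>S\<close> of \<open>T\<close>: the terms with \<open>k < s < t\<close> are zero, and the term
  \<open>S = T\<close> is the right-hand side.
\<close>
lemma gram_proj_coeff:
  fixes R T :: "'a::finite set"
  assumes "card R \<le> k" "k < card T"
  shows "(\<Sum>S | S \<subseteq> T \<and> card S \<le> k. proj_coeff k (card S) (card T) * min_gram S R) = min_gram T R"
proof -
  let ?r = "card R" and ?t = "card T"
  define G :: "real poly" where "G = [:real ?r + 2, 1:] * (\<Prod>m\<in>{2..k + 1}. [:real m, 1:])
    * (\<Prod>m\<in>{k + 1..<?t}. [:- real m, 1:])"
  have polyG: "poly G x = (x + real ?r + 2) * (\<Prod>m\<in>{2..k + 1}. x + real m)
    * (\<Prod>m\<in>{k + 1..<?t}. x - real m)" for x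
    by (simp add: G_def poly_prod algebra_simps)
  have "degree G \<le> 1 + (\<Sum>m\<in>{2..k + 1}. 1) + (\<Sum>m\<in>{k + 1..<?t}. 1)"
    unfolding G_def
    by (intro order.trans[OF degree_mult_le] add_mono order.trans[OF degree_prod_sum_le]) auto
  also have "\<dots> = card (T \<inter> R) + card (T - R)"
    using assms card_Int_Diff[of T R] by simp
  finally have degG: "degree G \<le> card (T \<inter> R) + card (T - R)" .
  have roots: "poly G (real p - (real ?r + 2)) = 0" if "p \<le> card (T \<inter> R)" for p
  proof -
    have pr: "p \<le> ?r" using that card_mono[of R "T \<inter> R"] by simp
    \<comment> \<open>The factor \<open>s + r + 2\<close> of \<open>G\<close> vanishes for \<open>p = 0\<close>, the factor \<open>s + (r + 2 - p)\<close> for \<open>1 \<le> p \<le> r\<close>;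
      the latter is present because \<open>2 \<le> r + 2 - p \<le> k + 1\<close>.\<close>
    show ?thesis
    proof (cases "p = 0")
      case False
      then have "?r + 2 - p \<in> {2..k + 1}" using pr assms by auto
      moreover have "real p - (real ?r + 2) + real (?r + 2 - p) = 0" using pr by simp
      ultimately show ?thesis unfolding polyG by (subst prod_zero) auto
    qed (simp add: polyG)
  qed
  have union: "card (S \<union> R) = ?r + card (S - R)" for S
    using card_Un_disjoint[of R "S - R"] by (simp add: Un_commute)
  define h where "h S = (-1) ^ card S * poly G (real (card S)) / (real ?r + 2 + real (card (S - R)))" for S
  have "(\<Sum>S\<in>Pow T. h S) = 0"
    unfolding h_def
    using alternating_sum_div_eq_0[OF _ _ degG _ roots]
      sum_Pow_split[of T "\<lambda>s q. (-1) ^ s * poly G (real s) / (real ?r + 2 + real q)" R] by simp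
  moreover have split: "Pow T = insert T ({S. S \<subseteq> T \<and> card S \<le> k} \<union> {S. S \<subset> T \<and> k < card S})"
    by auto
  moreover have "h S = 0" if "S \<subset> T" "k < card S" for S
  proof -
    have "card S < ?t" using that by (simp add: psubset_card_mono)
    then show ?thesis using that unfolding h_def polyG by (subst (2) prod_zero) auto
  qed
  ultimately have sum0: "h T + (\<Sum>S | S \<subseteq> T \<and> card S \<le> k. h S) = 0"
  proof -
    assume "sum h (Pow T) = 0" and "\<And>S. S \<subset> T \<Longrightarrow> k < card S \<Longrightarrow> h S = 0"
    moreover from this(2) have "sum h {S. S \<subset> T \<and> k < card S} = 0" by (intro sum.neutral) auto
    moreover have "sum h (Pow T) = h T + (sum h {S. S \<subseteq> T \<and> card S \<le> k} + sum h {S. S \<subset> T \<and> k < card S})"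
      using assms unfolding split by (subst sum.union_disjoint[symmetric]) auto
    ultimately show ?thesis by simp
  qed
  define K where "K = (-1) ^ ?t * fact (k + 1) * fact (?t - k - 1)
    * real (k + ?t + 1 choose (k + 1)) * (real ?r + 1)"
  have K0: "K \<noteq> 0" by (simp add: K_def binomial_eq_0_iff add_nonneg_pos less_imp_neq[THEN not_sym] del: binomial_Suc_Suc)
  have gram: "min_gram S R = (real (card S) + real ?r + 2)
      / ((real (card S) + 1) * (real ?r + 1) * (real ?r + 2 + real (card (S - R))))" for S
    unfolding min_gram_def union by (simp add: add_ac)
  have hT: "h T = K * min_gram T R"
  proof -
    have "(\<Prod>m\<in>{k + 1..<?t}. real ?t - real m) = fact (?t - k - 1)"
    proof -
      have "(\<Prod>m\<in>{k + 1..<?t}. real ?t - real m) = (\<Prod>m\<in>{1..?t - k - 1}. real m)"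
        using assms by (intro prod.reindex_bij_witness[where i = "\<lambda>m. ?t - m" and j = "\<lambda>m. ?t - m"])
          (auto simp: of_nat_diff)
      then show ?thesis by (simp add: fact_prod)
    qed
    moreover have "(\<Prod>m\<in>{2..k + 1}. real ?t + real m)
      = real (k + ?t + 1 choose (k + 1)) * fact (k + 1) / (real ?t + 1)"
      by (simp only: prod_shift_up) (simp add: add_nonneg_pos less_imp_neq[THEN not_sym])
    moreover have "sg * ((t + r + 2) * (C * F / (t + 1)) * F') / (r + 2 + q)
      = sg * F * F' * C * (r + 1) * ((t + r + 2) / ((t + 1) * (r + 1) * (r + 2 + q)))"
      if "r \<ge> 0" for sg t r q C F F' :: real
      using that by simp
    ultimately show ?thesis
      unfolding h_def polyG K_def gram by simp
  qed
  have hS: "h S = - (K * (proj_coeff k (card S) ?t * min_gram S R))" if "S \<subseteq> T" "card S \<le> k" for S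
  proof -
    have "(\<Prod>m\<in>{k + 1..<?t}. real (card S) - real m)
      = (\<Prod>m\<in>{k + 1..<?t}. (-1) * (real m - real (card S)))" by simp
    also have "\<dots> = (-1) ^ (?t - k - 1) * (\<Prod>m\<in>{k + 1..<?t}. real m - real (card S))"
      unfolding prod.distrib by simp
    also have "(-1) ^ (?t - k - 1) = - ((-1) ^ ?t * (-1) ^ k :: real)"
      using assms by (auto simp: minus_one_power_iff)
    finally have down: "(\<Prod>m\<in>{k + 1..<?t}. real (card S) - real m)
      = - ((-1) ^ ?t * (-1) ^ k) * (real (?t - card S - 1 choose (k - card S)) * fact (?t - k - 1))"
      by (simp only: prod_shift_down[OF that(2) assms(2)])
    have up: "(\<Prod>m\<in>{2..k + 1}. real (card S) + real m)
      = real (k + card S + 1 choose (k + 1)) * fact (k + 1) / (real (card S) + 1)"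
      by (simp only: prod_shift_up) (simp add: add_nonneg_pos less_imp_neq[THEN not_sym])
    have C': "real (k + ?t + 1 choose (k + 1)) \<noteq> 0"
      by (simp add: binomial_eq_0_iff del: binomial_Suc_Suc)
    have alg: "sgS * ((s + r + 2) * (C * F / (s + 1)) * (- (sgT * sgk) * (B * F'))) / (r + 2 + q)
      = - (sgT * F * F' * C' * (r + 1) * (sgk * sgS * (C * B / C')
          * ((s + r + 2) / ((s + 1) * (r + 1) * (r + 2 + q)))))"
      if "r \<ge> 0" "C' \<noteq> 0" for sgS sgT sgk s r q C C' F F' B :: real
      using that by simp
    show ?thesis
      unfolding h_def polyG up down K_def gram proj_coeff_def power_add[of _ k]
      by (rule alg[OF _ C']) simp
  qed
  have "K * (\<Sum>S | S \<subseteq> T \<and> card S \<le> k. proj_coeff k (card S) ?t * min_gram S R) = K * min_gram T R"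
    using sum0 hT hS by (simp add: sum_distrib_left sum_negf)
  with K0 show ?thesis by simp
qed

section \<open>Inner products of minima\<close>
lemma unit_cube_eq_cbox: "unit_cube = cbox 0 (1 :: real ^ 'n)"
  by (auto simp: unit_cube_def mem_box_cart)

lemma min_on_in_unit_interval:
  assumes "x \<in> unit_cube" shows "min_on S x \<in> {0..1}"
proof (cases "S = {}")
  case False
  then have "Min ((\<lambda>i. x $ i) ` S) \<in> (\<lambda>i. x $ i) ` S" by (intro Min_in) auto
  then obtain i where "min_on S x = x $ i" using False unfolding min_on_def by (auto simp only: if_False)
  then show ?thesis using assms by (simp add: unit_cube_def)
qed (simp add: min_on_def)

lemma le_min_on_iff:
  assumes "u \<le> 1" shows "u \<le> min_on S x \<longleftrightarrow> (\<forall>i\<in>S. u \<le> x $ i)"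
  using assms by (simp add: min_on_def)

lemma continuous_on_min_on: "continuous_on A (min_on S)"
proof -
  have "continuous_on A (\<lambda>x. Min ((\<lambda>i. x $ i) ` S))" if "S \<noteq> {}"
    using finite[of S] that
  proof (induction S rule: finite_ne_induct)
    case (insert i S)
    then show ?case by (simp add: continuous_on_min continuous_intros)
  qed (simp add: continuous_intros)
  then show ?thesis unfolding min_on_def by (cases "S = {}") simp_all
qed

lemma borel_measurable_min_on [measurable]: "min_on S \<in> borel_measurable borel"
  by (intro borel_measurable_continuous_onI continuous_on_min_on)

text \<open>
  The condition \<open>u \<le> min_on S x\<close> does not bound \<open>u\<close> from below, so \<open>0 \<le> u\<close> is included to
  make the integral over \<open>u\<close> equal to the minimum.
\<close>
definition level_ind :: "'n::finite set \<Rightarrow> real \<Rightarrow> real ^ 'n \<Rightarrow> ennreal" where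
  "level_ind S u x = (if 0 \<le> u \<and> u \<le> min_on S x then 1 else 0)"

lemma measurable_level_ind [measurable]:
  assumes [measurable]: "f \<in> borel_measurable M" "g \<in> borel_measurable M"
  shows "(\<lambda>p. level_ind S (f p) (g p)) \<in> borel_measurable M"
  unfolding level_ind_def by measurable

lemma min_on_layer_cake:
  assumes "x \<in> unit_cube"
  shows "(\<integral>\<^sup>+u. level_ind S u x \<partial>lborel) = ennreal (min_on S x)"
proof -
  have "level_ind S u x = indicator {0..min_on S x} u" for u
    by (simp add: level_ind_def indicator_def)
  then show ?thesis using min_on_in_unit_interval[OF assms, of S] by simp
qed

text \<open>
  Each coordinate is constrained separately: by \<open>u\<close> on \<open>S - R\<close>, by \<open>v\<close> on \<open>R - S\<close>, by both on
  \<open>S \<inter> R\<close>, and by neither elsewhere. So the set is a box with upper corner 1.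
\<close>
lemma emeasure_corner_box:
  fixes S R :: "'n::finite set"
  assumes "u \<in> {0..1}" "v \<in> {0..1}"
  shows "emeasure lborel {x::real ^ 'n. x \<in> unit_cube \<and> (\<forall>i\<in>S. u \<le> x $ i) \<and> (\<forall>i\<in>R. v \<le> x $ i)}
    = ennreal ((1 - u) ^ card (S - R) * (1 - v) ^ card (R - S) * (1 - max u v) ^ card (S \<inter> R))"
proof -
  define l :: "real ^ 'n" where "l = (\<chi> i. max (if i \<in> S then u else 0) (if i \<in> R then v else 0))"
  have l01: "0 \<le> l $ i" "l $ i \<le> 1" for i using assms by (auto simp: l_def)
  have "{x::real ^ 'n. x \<in> unit_cube \<and> (\<forall>i\<in>S. u \<le> x $ i) \<and> (\<forall>i\<in>R. v \<le> x $ i)} = cbox l 1"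
    using assms by (auto simp: unit_cube_def mem_box_cart l_def split: if_splits) (metis order.trans)+
  moreover have "emeasure lborel (cbox l 1) = ennreal (\<Prod>i\<in>UNIV. 1 - l $ i)"
  proof -
    have "cbox l 1 \<noteq> {}" using l01 by (auto simp: interval_ne_empty_cart)
    then have "measure lborel (cbox l 1) = (\<Prod>i\<in>UNIV. 1 - l $ i)"
      by (subst content_cbox_cart) auto
    then show ?thesis
      using emeasure_lborel_cbox_finite[of l 1] by (subst emeasure_eq_ennreal_measure) auto
  qed
  moreover have "(\<Prod>i\<in>UNIV. 1 - l $ i)
    = (1 - u) ^ card (S - R) * (1 - v) ^ card (R - S) * (1 - max u v) ^ card (S \<inter> R)"
  proof -
    have "(\<Prod>i\<in>UNIV. 1 - l $ i) = (\<Prod>i\<in>(S - R) \<union> (R - S) \<union> (S \<inter> R) \<union> - (S \<union> R). 1 - l $ i)"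
      by (rule prod.cong) auto
    also have "\<dots> = (\<Prod>i\<in>S - R. 1 - l $ i) * (\<Prod>i\<in>R - S. 1 - l $ i) * (\<Prod>i\<in>S \<inter> R. 1 - l $ i)
        * (\<Prod>i\<in>- (S \<union> R). 1 - l $ i)"
      by (subst prod.union_disjoint; (subst prod.union_disjoint)?; (subst prod.union_disjoint)?; auto)
    also have "\<dots> = (\<Prod>i\<in>S - R. 1 - u) * (\<Prod>i\<in>R - S. 1 - v) * (\<Prod>i\<in>S \<inter> R. 1 - max u v)
        * (\<Prod>i\<in>- (S \<union> R). 1)"
      using assms by (intro arg_cong2[where f = "(*)"] prod.cong refl) (auto simp: l_def)
    finally show ?thesis by simp
  qed
  ultimately show ?thesis by simp
qed

lemma has_integral_power_one_minus:
  assumes "a \<le> b"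
  shows "((\<lambda>u. (1 - u) ^ m) has_integral
    ((1 - a) ^ Suc m - (1 - b) ^ Suc m) / real (Suc m)) {a..b :: real}"
proof -
  have "((\<lambda>u. - ((1 - u) ^ Suc m) / real (Suc m)) has_vector_derivative (1 - u) ^ m) (at u within {a..b})" for u
    unfolding has_real_derivative_iff_has_vector_derivative[symmetric]
    by (rule derivative_eq_intros refl | simp)+
  from fundamental_theorem_of_calculus[OF assms this] show ?thesis
    by (simp add: diff_divide_distrib)
qed

text \<open>
  The volume of the box is now integrated over \<open>u\<close> and then over \<open>v\<close>. The maximum makes
  the inner integrand piecewise polynomial with a break at \<open>u = v\<close>.
\<close>
lemma has_integral_corner_inner:
  assumes "v \<in> {0..1}"
  shows "((\<lambda>u. (1 - u) ^ a * (1 - v) ^ b * (1 - max u v) ^ c) has_integral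
     (1 - v) ^ (b + c) / real (a + 1)
     - (real c / (real (a + 1) * real (a + c + 1))) * (1 - v) ^ (a + b + c + 1)) {0..1 :: real}"
proof -
  have "((\<lambda>u. (1 - u) ^ a * (1 - v) ^ b * (1 - max u v) ^ c) has_integral
      (((1 - 0) ^ Suc a - (1 - v) ^ Suc a) / real (Suc a)) * (1 - v) ^ (b + c)) {0..v}"
    by (rule has_integral_eq[rotated], rule has_integral_mult_left[OF has_integral_power_one_minus])
      (use assms in \<open>auto simp: power_add max_def\<close>)
  moreover have "((\<lambda>u. (1 - u) ^ a * (1 - v) ^ b * (1 - max u v) ^ c) has_integral
      (((1 - v) ^ Suc (a + c) - (1 - 1) ^ Suc (a + c)) / real (Suc (a + c))) * (1 - v) ^ b) {v..1}"
    by (rule has_integral_eq[rotated], rule has_integral_mult_left[OF has_integral_power_one_minus])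
      (use assms in \<open>auto simp: power_add max_def\<close>)
  ultimately have "((\<lambda>u. (1 - u) ^ a * (1 - v) ^ b * (1 - max u v) ^ c) has_integral
      (((1 - 0) ^ Suc a - (1 - v) ^ Suc a) / real (Suc a)) * (1 - v) ^ (b + c)
      + (((1 - v) ^ Suc (a + c) - (1 - 1) ^ Suc (a + c)) / real (Suc (a + c))) * (1 - v) ^ b) {0..1}"
    using assms by (intro has_integral_combine[where c = v]) auto
  moreover have "(((1 - 0) ^ Suc a - (1 - v) ^ Suc a) / real (Suc a)) * (1 - v) ^ (b + c)
      + (((1 - v) ^ Suc (a + c) - (1 - 1) ^ Suc (a + c)) / real (Suc (a + c))) * (1 - v) ^ b
     = (1 - v) ^ (b + c) / real (a + 1)
     - (real c / (real (a + 1) * real (a + c + 1))) * (1 - v) ^ (a + b + c + 1)"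
    by (simp add: divide_simps add_nonneg_pos less_imp_neq[THEN not_sym]) (simp add: algebra_simps power_add)
  ultimately show ?thesis by simp
qed

lemma has_integral_corner_outer:
  "((\<lambda>v. (1 - v) ^ (b + c) / real (a + 1)
     - (real c / (real (a + 1) * real (a + c + 1))) * (1 - v) ^ (a + b + c + 1)) has_integral
    real (a + b + 2 * c + 2) / (real (a + c + 1) * real (b + c + 1) * real (a + b + c + 2))) {0..1 :: real}"
proof -
  have "((\<lambda>v. (1 - v) ^ (b + c) / real (a + 1)
     - (real c / (real (a + 1) * real (a + c + 1))) * (1 - v) ^ (a + b + c + 1)) has_integral
     ((1 - 0) ^ Suc (b + c) - (1 - 1) ^ Suc (b + c)) / real (Suc (b + c)) / real (a + 1)
     - (real c / (real (a + 1) * real (a + c + 1)))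
      * (((1 - 0) ^ Suc (a + b + c + 1) - (1 - 1) ^ Suc (a + b + c + 1)) / real (Suc (a + b + c + 1)))) {0..1 :: real}"
    by (intro has_integral_diff has_integral_divide has_integral_mult_right has_integral_power_one_minus) auto
  moreover have "1 / real (Suc (b + c)) / real (a + 1)
     - (real c / (real (a + 1) * real (a + c + 1))) * (1 / real (Suc (a + b + c + 1)))
    = real (a + b + 2 * c + 2) / (real (a + c + 1) * real (b + c + 1) * real (a + b + c + 2))"
    by (simp add: divide_simps add_nonneg_pos less_imp_neq[THEN not_sym]) (simp add: algebra_simps)
  ultimately show ?thesis by simp
qed


lemma nn_integral_level_ind:
  fixes S R :: "'n::finite set"
  shows "(\<integral>\<^sup>+x. indicator unit_cube x * level_ind R v x * level_ind S u x \<partial>lborel)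
    = ennreal ((1 - u) ^ card (S - R) * (1 - v) ^ card (R - S) * (1 - max u v) ^ card (S \<inter> R))
      * indicator {0..1} u * indicator {0..1} v"
proof (cases "u \<in> {0..1} \<and> v \<in> {0..1}")
  case True
  let ?E = "{x::real ^ 'n. x \<in> unit_cube \<and> (\<forall>i\<in>S. u \<le> x $ i) \<and> (\<forall>i\<in>R. v \<le> x $ i)}"
  have "indicator unit_cube x * level_ind R v x * level_ind S u x = indicator ?E x" for x
    using True by (auto simp: level_ind_def indicator_def le_min_on_iff)
  moreover have "?E = unit_cube \<inter> {x. u \<le> min_on S x} \<inter> {x. v \<le> min_on R x}"
    using True by (auto simp: le_min_on_iff)
  then have "?E \<in> sets lborel"
    by (simp add: unit_cube_eq_cbox)
  ultimately show ?thesis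
    using True emeasure_corner_box[of u v S R] by simp
next
  case False
  have "indicator unit_cube x * level_ind R v x * level_ind S u x = 0" for x
  proof (cases "x \<in> unit_cube")
    case True
    then show ?thesis
      using False min_on_in_unit_interval[OF True, of S] min_on_in_unit_interval[OF True, of R]
      by (auto simp: level_ind_def)
  qed simp
  then have "(\<integral>\<^sup>+x. indicator unit_cube x * level_ind R v x * level_ind S u x \<partial>lborel) = 0"
    by (simp only: nn_integral_const mult_zero_left)
  then show ?thesis using False by (auto simp: indicator_def)
qed

text \<open>
  The layer cake representation of both factors turns the integral over the cube into an integral
  over \<open>x\<close>, \<open>u\<close>, \<open>v\<close>. Tonelli's theorem moves the integral over \<open>x\<close> inside, where it is the
  volume of a box.
\<close>
lemma nn_integral_min_on_mult_min_on:
  fixes S R :: "'n::finite set"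
  shows "(\<integral>\<^sup>+x. ennreal (indicator unit_cube x * (min_on S x * min_on R x)) \<partial>lborel)
    = ennreal (min_gram S R)"
proof -
  have [measurable]: "unit_cube \<in> sets (borel :: (real ^ 'n) measure)"
    by (simp add: unit_cube_eq_cbox)
  define a b c where "a = card (S - R)" and "b = card (R - S)" and "c = card (S \<inter> R)"
  have "(\<integral>\<^sup>+x. ennreal (indicator unit_cube x * (min_on S x * min_on R x)) \<partial>lborel)
    = (\<integral>\<^sup>+x. (\<integral>\<^sup>+v. (\<integral>\<^sup>+u. indicator unit_cube x * level_ind R v x * level_ind S u x \<partial>lborel) \<partial>lborel) \<partial>lborel)"
  proof (rule nn_integral_cong)
    fix x :: "real ^ 'n"
    show "ennreal (indicator unit_cube x * (min_on S x * min_on R x))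
      = (\<integral>\<^sup>+v. (\<integral>\<^sup>+u. indicator unit_cube x * level_ind R v x * level_ind S u x \<partial>lborel) \<partial>lborel)"
    proof (cases "x \<in> unit_cube")
      case True
      then show ?thesis
        using min_on_in_unit_interval[OF True, of S] min_on_in_unit_interval[OF True, of R]
        by (simp add: nn_integral_cmult nn_integral_multc min_on_layer_cake ennreal_mult mult.commute)
    qed simp
  qed
  also have "\<dots> = (\<integral>\<^sup>+v. (\<integral>\<^sup>+x. (\<integral>\<^sup>+u. indicator unit_cube x * level_ind R v x * level_ind S u x \<partial>lborel) \<partial>lborel) \<partial>lborel)"
    by (rule lborel_pair.Fubini') measurable
  also have "\<dots> = (\<integral>\<^sup>+v. (\<integral>\<^sup>+u. (\<integral>\<^sup>+x. indicator unit_cube x * level_ind R v x * level_ind S u x \<partial>lborel) \<partial>lborel) \<partial>lborel)"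
    by (intro nn_integral_cong lborel_pair.Fubini') measurable
  also have "\<dots> = (\<integral>\<^sup>+v. (\<integral>\<^sup>+u. ennreal ((1 - u) ^ a * (1 - v) ^ b * (1 - max u v) ^ c)
      * indicator {0..1} u \<partial>lborel) * indicator {0..1} v \<partial>lborel)"
    unfolding nn_integral_level_ind a_def b_def c_def
    by (subst nn_integral_multc) (auto simp: mult_ac)
  also have "\<dots> = (\<integral>\<^sup>+v. ennreal ((1 - v) ^ (b + c) / real (a + 1)
     - (real c / (real (a + 1) * real (a + c + 1))) * (1 - v) ^ (a + b + c + 1)) * indicator {0..1} v \<partial>lborel)"
  proof (rule nn_integral_cong)
    fix v :: real
    show "(\<integral>\<^sup>+u. ennreal ((1 - u) ^ a * (1 - v) ^ b * (1 - max u v) ^ c) * indicator {0..1} u \<partial>lborel) * indicator {0..1} v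
      = ennreal ((1 - v) ^ (b + c) / real (a + 1)
     - (real c / (real (a + 1) * real (a + c + 1))) * (1 - v) ^ (a + b + c + 1)) * indicator {0..1} v"
    proof (cases "v \<in> {0..1}")
      case True
      then show ?thesis
        by (subst nn_integral_has_integral_lebesgue'[OF _ has_integral_corner_inner]) auto
    qed simp
  qed
  also have "\<dots> = ennreal (real (a + b + 2 * c + 2) / (real (a + c + 1) * real (b + c + 1) * real (a + b + c + 2)))"
  proof (rule nn_integral_has_integral_lebesgue'[OF _ has_integral_corner_outer])
    fix v :: real assume v: "v \<in> {0..1}"
    show "0 \<le> (1 - v) ^ (b + c) / real (a + 1)
     - (real c / (real (a + 1) * real (a + c + 1))) * (1 - v) ^ (a + b + c + 1)"
      using v by (intro has_integral_nonneg[OF has_integral_corner_inner[OF v]]) auto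
  qed
  also have "real (a + b + 2 * c + 2) / (real (a + c + 1) * real (b + c + 1) * real (a + b + c + 2)) = min_gram S R"
  proof -
    have "card S = a + c" "card R = b + c"
      using card_Int_Diff[of S R] card_Int_Diff[of R S] by (simp_all add: a_def b_def c_def Int_commute)
    moreover have "card (S \<union> R) = a + b + c"
      using card_Un_Int[of S R] calculation by (simp add: c_def)
    ultimately show ?thesis by (simp add: min_gram_def)
  qed
  finally show ?thesis .
qed

lemma set_integrable_min_on_mult_min_on:
  "set_integrable lborel unit_cube (\<lambda>x. min_on S x * min_on R x)"
  unfolding set_integrable_def unit_cube_eq_cbox
  by (intro borel_integrable_compact compact_cbox continuous_intros continuous_on_min_on)

lemma cube_inner_min_on: "cube_inner (min_on S) (min_on R) = min_gram S R"
proof -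
  have "cube_inner (min_on S) (min_on R)
      = enn2real (\<integral>\<^sup>+x. ennreal (indicator unit_cube x * (min_on S x * min_on R x)) \<partial>lborel)"
    unfolding cube_inner_def set_lebesgue_integral_def
    using set_integrable_min_on_mult_min_on[of S R] min_on_in_unit_interval
    by (subst integral_eq_nn_integral)
      (auto simp: set_integrable_def indicator_def intro!: AE_I2 mult_nonneg_nonneg)
  then show ?thesis by (simp add: nn_integral_min_on_mult_min_on min_gram_def)
qed

section \<open>Min-polynomials and the projection\<close>

text \<open>
  The same sum as in \<open>min_poly\<close>, but over all index sets and not restricted to the cube, so that it is
  linear in the coefficients and continuous everywhere. The bound on the degree is moved into the
  coefficients by \<open>truncate_coeffs\<close>.
\<close>
definition min_comb :: "('n::finite set \<Rightarrow> real) \<Rightarrow> real ^ 'n \<Rightarrow> real" where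
  "min_comb a x = (\<Sum>S\<in>UNIV. a S * min_on S x)"

definition truncate_coeffs :: "nat \<Rightarrow> ('n::finite set \<Rightarrow> real) \<Rightarrow> 'n set \<Rightarrow> real" where
  "truncate_coeffs k a S = (if card S \<le> k then a S else 0)"

lemma min_poly_eq_min_comb:
  assumes "x \<in> unit_cube" shows "min_poly k a x = min_comb (truncate_coeffs k a) x"
proof -
  have "min_comb (truncate_coeffs k a) x = (\<Sum>S | card S \<le> k. a S * min_on S x)"
    unfolding min_comb_def truncate_coeffs_def by (rule sum.mono_neutral_cong_right) auto
  then show ?thesis using assms by (simp add: min_poly_def)
qed

lemma min_comb_diff: "min_comb a x - min_comb b x = min_comb (\<lambda>S. a S - b S) x"
  by (simp add: min_comb_def sum_subtractf left_diff_distrib)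

lemma cube_inner_cong:
  assumes "\<And>x. x \<in> unit_cube \<Longrightarrow> f x = f' x" "\<And>x. x \<in> unit_cube \<Longrightarrow> g x = g' x"
  shows "cube_inner f g = cube_inner f' g'"
  unfolding cube_inner_def set_lebesgue_integral_def
  using assms by (intro Bochner_Integration.integral_cong) (auto simp: indicator_def)

lemma cube_inner_min_comb:
  "cube_inner (min_comb a) (min_comb b) = (\<Sum>R\<in>UNIV. b R * (\<Sum>S\<in>UNIV. a S * min_gram S R))"
proof -
  have "cube_inner (min_comb a) (min_comb b)
    = (LINT x:unit_cube|lborel. (\<Sum>R\<in>UNIV. \<Sum>S\<in>UNIV. (b R * a S) * (min_on S x * min_on R x)))"
    unfolding cube_inner_def min_comb_def
    by (subst sum.swap) (simp add: sum_product mult_ac)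
  also have "\<dots> = (\<Sum>R\<in>UNIV. \<Sum>S\<in>UNIV. (b R * a S) * (LINT x:unit_cube|lborel. min_on S x * min_on R x))"
  proof -
    have "integrable lborel (\<lambda>x. indicator unit_cube x *\<^sub>R ((b R * a S) * (min_on S x * min_on R x)))" for R S
      using set_integrable_mult_right[OF set_integrable_min_on_mult_min_on] by (simp only: set_integrable_def)
    then have "(LINT x:unit_cube|lborel. (\<Sum>R\<in>UNIV. \<Sum>S\<in>UNIV. (b R * a S) * (min_on S x * min_on R x)))
      = (\<Sum>R\<in>UNIV. \<Sum>S\<in>UNIV. (LINT x:unit_cube|lborel. (b R * a S) * (min_on S x * min_on R x)))"
      unfolding set_lebesgue_integral_def scaleR_sum_right
      by (simp only: Bochner_Integration.integral_sum Bochner_Integration.integrable_sum)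
    then show ?thesis by (simp only: set_integral_mult_right)
  qed
  also have "\<dots> = (\<Sum>R\<in>UNIV. b R * (\<Sum>S\<in>UNIV. a S * min_gram S R))"
    by (simp flip: cube_inner_min_on add: cube_inner_def sum_distrib_left mult.assoc)
  finally show ?thesis .
qed

lemma cube_inner_self_eq_0D:
  assumes "cube_inner (min_comb d) (min_comb d) = 0" "x \<in> unit_cube"
  shows "min_comb d x = 0"
proof -
  have cont: "continuous_on (cbox 0 1) (\<lambda>x. min_comb d x * min_comb d x)"
    unfolding min_comb_def by (intro continuous_intros continuous_on_min_on)
  then have "set_integrable lborel (cbox 0 1) (\<lambda>x. min_comb d x * min_comb d x)"
    unfolding set_integrable_def by (intro borel_integrable_compact) auto
  from set_borel_integral_eq_integral[OF this] assms(1)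
  have "((\<lambda>x. min_comb d x * min_comb d x) has_integral 0) (cbox 0 1)"
    unfolding cube_inner_def unit_cube_eq_cbox by (simp add: has_integral_integral)
  then have "min_comb d x * min_comb d x = 0"
    using assms(2) unfolding unit_cube_eq_cbox
    by (intro has_integral_0_cbox_imp_0[OF cont]) (auto simp: interval_ne_empty_cart)
  then show ?thesis by simp
qed

lemma min_on_indicator: "min_on S (\<chi> i. if i \<in> T then 1 else 0) = (if S \<subseteq> T then 1 else 0)"
proof (cases "S \<subseteq> T")
  case True
  then have "(\<lambda>i. (\<chi> i. if i \<in> T then (1::real) else 0) $ i) ` S = (\<lambda>i. 1) ` S" by auto
  then show ?thesis using True by (auto simp: min_on_def)
next
  case False
  then have "Min ((\<lambda>i. (\<chi> i. if i \<in> T then (1::real) else 0) $ i) ` S) = 0"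
    by (intro Min_eqI) auto
  then show ?thesis using False by (auto simp: min_on_def)
qed

text \<open>
  At the vertex of the cube that indicates \<open>T\<close>, a min-polynomial is the sum of its coefficients over the
  subsets of \<open>T\<close>. If all these sums vanish, so do the coefficients, by induction on \<open>T\<close>.
\<close>
lemma min_comb_eq_0D:
  fixes d :: "'n::finite set \<Rightarrow> real"
  assumes "\<And>x. x \<in> unit_cube \<Longrightarrow> min_comb d x = 0"
  shows "d T = 0"
  using finite[of T]
proof (induction T rule: finite_psubset_induct)
  case (psubset T)
  have "0 = min_comb d (\<chi> i. if i \<in> T then 1 else 0)"
    by (rule assms[symmetric]) (simp add: unit_cube_def)
  also have "\<dots> = (\<Sum>S\<in>Pow T. d S)"
    unfolding min_comb_def min_on_indicator by (rule sum.mono_neutral_cong_right) auto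
  also have "\<dots> = d T + (\<Sum>S\<in>Pow T - {T}. d S)"
    by (rule sum.remove) auto
  also have "(\<Sum>S\<in>Pow T - {T}. d S) = 0"
    by (rule sum.neutral) (auto intro: psubset)
  finally show ?case by simp
qed

lemma min_poly_eqD:
  assumes "min_poly k a = min_poly k b" "card S \<le> k"
  shows "a S = b S"
proof -
  have "truncate_coeffs k a S - truncate_coeffs k b S = 0"
    by (rule min_comb_eq_0D) (simp flip: min_comb_diff min_poly_eq_min_comb add: assms)
  then show ?thesis using assms(2) by (simp add: truncate_coeffs_def)
qed

text \<open>
  The definite description in \<open>min_proj\<close> is resolved here. For uniqueness, the difference
  \<open>e\<close> of two solutions lies in the space of approximants and is orthogonal to that space, hence
  to itself.
\<close>
lemma min_proj_eqI:
  fixes a b :: "'n::finite set \<Rightarrow> real"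
  assumes orth: "\<And>R. card R \<le> k \<Longrightarrow>
      (\<Sum>S\<in>UNIV. (truncate_coeffs m a S - truncate_coeffs k b S) * min_gram S R) = 0"
  shows "min_proj k (min_poly m a) = min_poly k b"
proof -
  let ?t = truncate_coeffs
  have inner: "cube_inner (\<lambda>x. min_poly m a x - min_poly k c x) (min_poly k e)
      = cube_inner (min_comb (\<lambda>S. ?t m a S - ?t k c S)) (min_comb (?t k e))" for c e
    by (rule cube_inner_cong) (simp_all add: min_poly_eq_min_comb min_comb_diff)
  have b0: "cube_inner (min_comb (\<lambda>S. ?t m a S - ?t k b S)) (min_comb (?t k e)) = 0" for e
    unfolding cube_inner_min_comb
    by (rule sum.neutral) (auto simp: truncate_coeffs_def[of k e] orth)
  show ?thesis
    unfolding min_proj_def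
  proof (rule the_equality)
    show "min_poly k b \<in> min_polys k
        \<and> (\<forall>h\<in>min_polys k. cube_inner (\<lambda>x. min_poly m a x - min_poly k b x) h = 0)"
      using inner b0 by (auto simp: min_polys_def)
  next
    fix g assume "g \<in> min_polys k
        \<and> (\<forall>h\<in>min_polys k. cube_inner (\<lambda>x. min_poly m a x - g x) h = 0)"
    then obtain c where g: "g = min_poly k c"
      and c0: "cube_inner (min_comb (\<lambda>S. ?t m a S - ?t k c S)) (min_comb (?t k e)) = 0" for e
      using inner by (auto simp: min_polys_def)
    define e where "e = (\<lambda>S. c S - b S)"
    have e: "?t k e S = (?t m a S - ?t k b S) - (?t m a S - ?t k c S)" for S
      by (simp add: truncate_coeffs_def e_def)
    have "cube_inner (min_comb (?t k e)) (min_comb (?t k e))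
      = cube_inner (min_comb (\<lambda>S. ?t m a S - ?t k b S)) (min_comb (?t k e))
        - cube_inner (min_comb (\<lambda>S. ?t m a S - ?t k c S)) (min_comb (?t k e))"
      unfolding cube_inner_min_comb sum_subtractf[symmetric] right_diff_distrib[symmetric]
        left_diff_distrib[symmetric] e[symmetric] ..
    then have "min_comb (?t k e) x = 0" if "x \<in> unit_cube" for x
      using b0 c0 that by (intro cube_inner_self_eq_0D) auto
    then have e0: "?t k e S = 0" for S by (rule min_comb_eq_0D)
    have "?t k c = ?t k b"
    proof
      fix S show "?t k c S = ?t k b S"
        using e0[of S] by (simp add: e_def truncate_coeffs_def split: if_splits)
    qed
    then have "min_poly k c x = min_poly k b x" if "x \<in> unit_cube" for x
      using that by (simp add: min_poly_eq_min_comb)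
    then show "g = min_poly k b"
      unfolding g min_poly_def by (auto simp: restrict_def fun_eq_iff)
  qed
qed


theorem theorem9:
  fixes k :: nat and a :: "'n::finite set \<Rightarrow> real" and f :: "real ^ 'n \<Rightarrow> real"
  assumes "k \<le> CARD('n)"
    and "f = min_poly CARD('n) a"
  shows "min_proj k f \<in> min_polys k \<and>
    (\<forall>ak. min_proj k f = min_poly k ak \<longrightarrow>
      (\<forall>S. card S \<le> k \<longrightarrow>
        ak S = a S + (-1) ^ (k + card S) *
          (\<Sum>T | S \<subseteq> T \<and> card T > k.
            real ((k + card S + 1) choose (k + 1)) * real ((card T - card S - 1) choose (k - card S))
              / real ((k + card T + 1) choose (k + 1)) * a T)))"
proof -
  define b where "b S = a S + (\<Sum>T | S \<subseteq> T \<and> card T > k. proj_coeff k (card S) (card T) * a T)" for S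
  let ?low = "{S :: 'n set. card S \<le> k}" and ?high = "{T :: 'n set. k < card T}"
  have "min_proj k (min_poly CARD('n) a) = min_poly k b"
  proof (rule min_proj_eqI)
    fix R :: "'n set" assume R: "card R \<le> k"
    \<comment> \<open>On sets of size at most \<open>k\<close> the coefficients of the error are \<open>a - b\<close>, on larger sets they
      are \<open>a\<close>. After exchanging the sums over \<open>S\<close> and \<open>T\<close> the two parts cancel for each \<open>T\<close>.\<close>
    have "(\<Sum>S\<in>UNIV. (truncate_coeffs CARD('n) a S - truncate_coeffs k b S) * min_gram S R)
      = (\<Sum>S\<in>?low \<union> ?high. (a S - truncate_coeffs k b S) * min_gram S R)"
      by (rule sum.cong) (auto simp: truncate_coeffs_def card_mono)
    also have "\<dots> = (\<Sum>S\<in>?low. (a S - b S) * min_gram S R) + (\<Sum>T\<in>?high. a T * min_gram T R)"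
      by (subst sum.union_disjoint) (auto simp: truncate_coeffs_def)
    also have "(\<Sum>S\<in>?low. (a S - b S) * min_gram S R)
      = - (\<Sum>S\<in>?low. \<Sum>T | T \<in> ?high \<and> S \<subseteq> T. a T * (proj_coeff k (card S) (card T) * min_gram S R))"
      by (simp add: b_def sum_distrib_left sum_distrib_right sum_negf conj_commute mult_ac)
    also have "(\<Sum>S\<in>?low. \<Sum>T | T \<in> ?high \<and> S \<subseteq> T. a T * (proj_coeff k (card S) (card T) * min_gram S R))
      = (\<Sum>T\<in>?high. \<Sum>S | S \<in> ?low \<and> S \<subseteq> T. a T * (proj_coeff k (card S) (card T) * min_gram S R))"
      by (rule sum.swap_restrict) auto
    also have "\<dots> = (\<Sum>T\<in>?high. a T * min_gram T R)"
      using R by (intro sum.cong) (auto simp: conj_commute gram_proj_coeff simp flip: sum_distrib_left)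
    finally show "(\<Sum>S\<in>UNIV. (truncate_coeffs CARD('n) a S - truncate_coeffs k b S) * min_gram S R) = 0"
      by simp
  qed
  moreover have "b S = a S + (-1) ^ (k + card S) *
          (\<Sum>T | S \<subseteq> T \<and> card T > k.
            real ((k + card S + 1) choose (k + 1)) * real ((card T - card S - 1) choose (k - card S))
              / real ((k + card T + 1) choose (k + 1)) * a T)" for S
    unfolding b_def proj_coeff_def sum_distrib_left by (simp only: mult.assoc)
  ultimately show ?thesis
    unfolding assms(2) by (metis min_poly_eqD min_polys_def rangeI)
qed

end
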